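(* (Generalized Laplace identity) Let $(\mathcal A,\mathcal A_0)$ be a commutative semiring pair with a negation map $(-)$, and let $A=(a_{i,j})$ be an $n\times n$ matrix over $\mathcal A$. Then for any $i$, $$|A|=\sum_{j=1}^n(-)^{i+j}a'_{i,j}a_{i,j}.$$ More generally, fix $I=\{i_1,\dots,i_m\}\subset\{1,\dots,n\}$ (with $m$ elements). Then $$|A|=\sum_{J\subset\{1,\dots,n\}:\,|J|=m}(-)^I(-)^J a'_{I,J}\,|a_{I,J}|.$$
   Context: $\mathcal T$ is a commutative multiplicative monoid with unit $1$, $\mathcal T_0=\mathcal T\cup\{0\}$. A semiring satisfies all ring axioms except existence of additive inverses ($0$ is additively neutral and multiplicatively absorbing). A commutative semiring pair $(\mathcal A,\mathcal A_0)$: $\mathcal A$ is a commutative semiring containing $\mathcal T_0$ (with $\mathcal T$ acting by multiplication, $\mathcal T$ a submonoid), such that $\mathcal T_0$ spans $(\mathcal A,+)$; $\mathcal A_0$ is an additive sub-semigroup containing $0$, closed under multiplication by $\mathcal T$, with $\mathcal A_0\cap\mathcal T_0=\{0\}$. Standing assumptions: for $a\in\mathcal T$, $b\in\mathcal A$, $ab\in\mathcal A_0$ implies $b\in\mathcal A_0$; $ab_1=ab_2$ implies $b_1=b_2$; and Property N: there is $1^\dag\in\mathcal T$ with $1+1^\dag\in\mathcal A_0$ and $1^\dag\mathcal T\subseteq\mathcal T$, and whenever $a_1,a_2\in\mathcal T$ and $a_1+a_2\in\mathcal A_0$, $a_1+a_2=a_1+a_11^\dag$. A negation map is an automorphism $(-)$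 of $(\mathcal A,+,0)$ of order $\le2$ leaving $\mathcal T$ invariant, with $1+((-)1)\in\mathcal A_0$ and $((-)a)b=(-)(ab)=a((-)b)$ for $a\in\mathcal T$, $b\in\mathcal A$. $(-)^k$ denotes the identity for $k$ even and $(-)$ for $k$ odd. The $(-)$-determinant of an $n\times n$ matrix is $|A|=\sum_{\pi\in S_n}(-)^\pi a_{\pi(1),1}\cdots a_{\pi(n),n}$, where $(-)^\pi$ is the identity for even $\pi$ and $(-)$ for odd $\pi$. $a'_{i,j}$ is the $(-)$-determinant of the matrix obtained from $A$ by deleting row $i$ and column $j$ (so that $(a'_{i,j})$ is the comatrix). For $J=\{j_1,\dots,j_m\}$, $(-)^J=(-)^{j_1+\dots+j_m}$, and similarly $(-)^I$; $(a_{I,J})$ is the $m\times m$ submatrix $(a_{i,j}:i\in I,j\in J)$, $|a_{I,J}|$ its $(-)$-determinant; $a'_{I,J}$ is the $(-)$-determinant of the $(n-m)\times(n-m)$ submatrix obtained by deleting all rows in $I$ and all columns in $J$. *)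

theory Defs
  imports "Jordan_Normal_Form.Determinant" "Jordan_Normal_Form.DL_Submatrix"
begin

text \<open>The semiring is the whole type. Its sort is that of commutative semirings with \<open>0\<close> and
  \<open>1\<close>; unlike \<^class>\<open>comm_semiring_1\<close> it does not impose \<open>0 \<noteq> 1\<close>. The set
  \<open>insert 0 T\<close> is \<open>T\<^sub>0\<close>.\<close>

locale semiring_pair =
  fixes T A0 :: "'a::{comm_semiring_0,comm_monoid_mult} set"
  assumes T_one: "1 \<in> T"
    and T_mult: "\<lbrakk>a \<in> T; b \<in> T\<rbrakk> \<Longrightarrow> a * b \<in> T"
    and T0_spans: "\<exists>xs. set xs \<subseteq> insert 0 T \<and> b = sum_list xs"
    and A0_zero: "0 \<in> A0"
    and A0_add: "\<lbrakk>b \<in> A0; c \<in> A0\<rbrakk> \<Longrightarrow> b + c \<in> A0"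
    and A0_T_mult: "\<lbrakk>a \<in> T; b \<in> A0\<rbrakk> \<Longrightarrow> a * b \<in> A0"
    and A0_Int_T0: "A0 \<inter> insert 0 T = {0}"

definition property_N :: "'a::{comm_semiring_0,comm_monoid_mult} set \<Rightarrow> 'a set \<Rightarrow> bool" where
  "property_N T A0 \<longleftrightarrow>
    (\<exists>e\<in>T. 1 + e \<in> A0 \<and> (\<forall>a\<in>T. e * a \<in> T) \<and>
      (\<forall>a1\<in>T. \<forall>a2\<in>T. a1 + a2 \<in> A0 \<longrightarrow> a1 + a2 = a1 + a1 * e))"

locale standing_semiring_pair = semiring_pair T A0
  for T A0 :: "'a::{comm_semiring_0,comm_monoid_mult} set" +
  assumes A0_cancel: "\<lbrakk>a \<in> T; a * b \<in> A0\<rbrakk> \<Longrightarrow> b \<in> A0"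
    and T_cancel: "\<lbrakk>a \<in> T; a * b1 = a * b2\<rbrakk> \<Longrightarrow> b1 = b2"
    and N: "property_N T A0"

text \<open>Bijectivity of a negation map is part of \<open>neg_neg\<close>.\<close>

locale negation_map =
  fixes T A0 :: "'a::{comm_semiring_0,comm_monoid_mult} set" and neg :: "'a \<Rightarrow> 'a"
  assumes neg_zero: "neg 0 = 0"
    and neg_add: "neg (b + c) = neg b + neg c"
    and neg_neg: "neg (neg b) = b"
    and neg_T: "neg ` T = T"
    and one_neg_one: "1 + neg 1 \<in> A0"
    and neg_mult_left: "a \<in> T \<Longrightarrow> neg a * b = neg (a * b)"
    and neg_mult_right: "a \<in> T \<Longrightarrow> a * neg b = neg (a * b)"

definition neg_pow :: "('a \<Rightarrow> 'a) \<Rightarrow> nat \<Rightarrow> 'a \<Rightarrow> 'a" where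
  "neg_pow neg k = (if even k then id else neg)"

definition neg_perm :: "('a \<Rightarrow> 'a) \<Rightarrow> (nat \<Rightarrow> nat) \<Rightarrow> 'a \<Rightarrow> 'a" where
  "neg_perm neg p = (if evenperm p then id else neg)"

text \<open>Matrix indices start at \<open>0\<close> in the library: index \<open>j\<close> stands for row or column \<open>Suc j\<close>
  in the usual numbering, and the signs are computed from the latter.\<close>

definition neg_set :: "('a \<Rightarrow> 'a) \<Rightarrow> nat set \<Rightarrow> 'a \<Rightarrow> 'a" where
  "neg_set neg J = neg_pow neg (\<Sum>j\<in>J. Suc j)"

text \<open>The value on non-square matrices is a dummy, as for \<^const>\<open>det\<close>. The
  determinant of the empty matrix is \<open>1\<close>.\<close>

definition neg_det :: "('a \<Rightarrow> 'a) \<Rightarrow> 'a::{comm_semiring_0,comm_monoid_mult} mat \<Rightarrow> 'a" where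
  "neg_det neg A = (if dim_row A = dim_col A then
     (\<Sum>p | p permutes {0..<dim_col A}. neg_perm neg p (\<Prod>j = 0..<dim_col A. A $$ (p j, j))) else 0)"

definition comatrix_entry ::
  "('a \<Rightarrow> 'a) \<Rightarrow> 'a::{comm_semiring_0,comm_monoid_mult} mat \<Rightarrow> nat \<Rightarrow> nat \<Rightarrow> 'a" where
  "comatrix_entry neg A i j = neg_det neg (mat_delete A i j)"

definition complementary_minor ::
  "('a \<Rightarrow> 'a) \<Rightarrow> 'a::{comm_semiring_0,comm_monoid_mult} mat \<Rightarrow> nat set \<Rightarrow> nat set \<Rightarrow> 'a" where
  "complementary_minor neg A I J =
     neg_det neg (submatrix A ({0..<dim_row A} - I) ({0..<dim_col A} - J))"

end

theory Submission
  imports Defs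
begin

text \<open>
  Since \<open>1\<close> belongs to \<open>T\<close>, a negation map is multiplication by the element \<open>e = neg 1\<close>, which
  satisfies \<open>e * e = 1\<close>. So the map that sends even permutations to \<open>1\<close> and odd ones to \<open>e\<close> is
  multiplicative (\<open>perm_sign_comp\<close>), and the classical proof of Laplace's
  expansion carries over, because it only regroups the terms of the permutation sum and never
  cancels any of them.

  Fix the row set \<open>I\<close> with \<open>m\<close> elements. A permutation \<open>p\<close> sends exactly one set \<open>J\<close> of columns
  onto \<open>I\<close>, and the terms of the determinant are grouped according to \<open>J\<close>. Let \<open>s\<close> be the
  shuffle that lists \<open>I\<close> in increasing order on \<open>0, \<dots>, m - 1\<close> and then the complement of \<open>I\<close>
  in increasing order, and let \<open>u\<close> be the same for \<open>J\<close>. Then \<open>p = s \<circ> q \<circ> u\<^sup>-\<^sup>1\<close>, where \<open>q\<close>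
  preserves the blocks \<open>{0..<m}\<close> and \<open>{m..<n}\<close>. Such a \<open>q\<close> is a pair of permutations, one of each
  block, so the sum over \<open>q\<close> is the product of the minor on \<open>I \<times> J\<close> and the complementary minor
  (\<open>sum_block_permutations\<close>, \<open>laplace_expansion_reindexed\<close>).

  What remains is the factor contributed by \<open>s\<close> and \<open>u\<close>. The parity of a shuffle is that of
  \<open>\<Sum>J + (0 + \<dots> + (m - 1))\<close> (\<open>evenperm_mono_on_blocks_iff\<close>). The second summand occurs for both \<open>I\<close>
  and \<open>J\<close> and drops out, which leaves the sign in the expansion. The expansion along one row is
  the case \<open>m = 1\<close>.
\<close>

section \<open>Signed permutation sums\<close>

text \<open>The image of the sign of \<open>p\<close> in a monoid where \<open>e\<close>, with \<open>e * e = 1\<close>, takes the place of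
  \<open>- 1\<close>.\<close>

definition perm_sign :: "'a::comm_monoid_mult \<Rightarrow> ('b \<Rightarrow> 'b) \<Rightarrow> 'a" where
  "perm_sign e p = (if evenperm p then 1 else e)"

lemma perm_sign_comp:
  assumes "e * e = 1" "p permutes S" "q permutes S" "finite S"
  shows "perm_sign e (p \<circ> q) = perm_sign e p * perm_sign e q"
  using assms by (auto simp: perm_sign_def evenperm_comp permutes_imp_permutation)

lemma perm_sign_inv:
  assumes "p permutes S" "finite S"
  shows "perm_sign e (inv_into UNIV p) = perm_sign e p"
  using assms by (simp add: perm_sign_def evenperm_inv permutes_imp_permutation)

text \<open>Allowing any index set makes it possible to speak of the determinant of a diagonal block
  in place, without renumbering its rows and columns.\<close>

definition det_on ::
  "'a::{comm_semiring_0,comm_monoid_mult} \<Rightarrow> 'b set \<Rightarrow> ('b \<Rightarrow> 'b \<Rightarrow> 'a) \<Rightarrow> 'a" where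
  "det_on e K a = (\<Sum>p | p permutes K. perm_sign e p * (\<Prod>k\<in>K. a (p k) k))"

lemma det_on_cong:
  assumes "\<And>i j. i \<in> K \<Longrightarrow> j \<in> K \<Longrightarrow> a i j = b i j"
  shows "det_on e K a = det_on e K b"
  unfolding det_on_def
  by (intro sum.cong refl arg_cong2[where f = "(*)"] prod.cong)
    (auto simp: assms permutes_in_image)

lemma det_on_reindex:
  assumes f: "bij_betw f K L" and fin: "finite K"
  shows "det_on e L a = det_on e K (\<lambda>i j. a (f i) (f j))"
proof -
  have inj: "inj_on f K" and im: "f ` K = L"
    using f by (auto simp: bij_betw_def)
  have bij: "bij_betw (map_permutation K f) {p. p permutes K} {p. p permutes L}"
    using bij_betw_permutations[OF f]
    by (rule bij_betw_cong[THEN iffD1, rotated])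
      (auto simp: map_permutation_def restrict_id_def im fun_eq_iff)
  show ?thesis
    unfolding det_on_def
  proof (subst sum.reindex_bij_betw[OF bij, symmetric], rule sum.cong[OF refl])
    fix p assume "p \<in> {p. p permutes K}"
    then have p: "p permutes K" by simp
    have "(\<Prod>k\<in>L. a (map_permutation K f p k) k) =
        (\<Prod>k\<in>K. a (map_permutation K f p (f k)) (f k))"
      by (rule prod.reindex_bij_betw[OF f, symmetric])
    also have "\<dots> = (\<Prod>k\<in>K. a (f (p k)) (f k))"
      by (rule prod.cong) (simp_all add: map_permutation_apply[OF inj])
    finally show "perm_sign e (map_permutation K f p) *
        (\<Prod>k\<in>L. a (map_permutation K f p k) k) =
        perm_sign e p * (\<Prod>k\<in>K. a (f (p k)) (f k))"
      by (simp add: perm_sign_def evenperm_map_permutation[OF inj p fin])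
  qed
qed

text \<open>A permutation of \<open>K \<union> L\<close> that preserves \<open>K\<close> also preserves \<open>L\<close>, hence it is a composition of
  a permutation of \<open>K\<close> and one of \<open>L\<close>, in a unique way. Both the sign and the product of entries
  split accordingly.\<close>

lemma sum_block_permutations:
  assumes e: "e * e = 1" and fin: "finite K" "finite L" and disj: "K \<inter> L = {}"
  shows "(\<Sum>q | q permutes (K \<union> L) \<and> q ` K = K.
            perm_sign e q * (\<Prod>k\<in>K \<union> L. b (q k) k)) =
         det_on e K b * det_on e L b"
proof -
  let ?t = "\<lambda>K q. perm_sign e q * (\<Prod>k\<in>K. b (q k) k)"
  have "det_on e K b * det_on e L b =
      (\<Sum>(q1, q2)\<in>{q. q permutes K} \<times> {q. q permutes L}. ?t K q1 * ?t L q2)"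
    by (simp add: det_on_def sum_product sum.cartesian_product)
  also have "\<dots> = (\<Sum>q | q permutes (K \<union> L) \<and> q ` K = K. ?t (K \<union> L) q)"
  proof (rule sum.reindex_bij_witness[of _
        "\<lambda>q. (restrict_id q K, restrict_id q L)" "\<lambda>(q1, q2). q1 \<circ> q2"])
    fix x assume "x \<in> {q. q permutes K} \<times> {q. q permutes L}"
    then obtain q1 q2 where x: "x = (q1, q2)" and q1: "q1 permutes K" and q2: "q2 permutes L"
      by auto
    have K: "(q1 \<circ> q2) k = q1 k" if "k \<in> K" for k
      using that disj by (simp add: permutes_not_in[OF q2] disjoint_iff)
    have L: "(q1 \<circ> q2) k = q2 k" if "k \<in> L" for k
      using that disj permutes_not_in[OF q1, of "q2 k"] permutes_in_image[OF q2, of k] by auto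
    have "restrict_id (q1 \<circ> q2) K = q1"
      using K permutes_not_in[OF q1] by (auto simp: restrict_id_def fun_eq_iff)
    moreover have "restrict_id (q1 \<circ> q2) L = q2"
      using L permutes_not_in[OF q2] by (auto simp: restrict_id_def fun_eq_iff)
    ultimately show "(case case x of (q1, q2) \<Rightarrow> q1 \<circ> q2 of q \<Rightarrow>
        (restrict_id q K, restrict_id q L)) = x"
      by (simp add: x)
    have q1': "q1 permutes (K \<union> L)" and q2': "q2 permutes (K \<union> L)"
      using q1 q2 by (auto intro: permutes_subset)
    have "(q1 \<circ> q2) ` K = q1 ` K"
      by (rule image_cong) (auto simp: K[simplified])
    then show "(case x of (q1, q2) \<Rightarrow> q1 \<circ> q2) \<in> {q. q permutes (K \<union> L) \<and> q ` K = K}"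
      using permutes_compose[OF q2' q1'] permutes_image[OF q1] by (simp add: x)
    have "(\<Prod>k\<in>K \<union> L. b ((q1 \<circ> q2) k) k) = (\<Prod>k\<in>K. b (q1 k) k) * (\<Prod>k\<in>L. b (q2 k) k)"
      using K L by (subst prod.union_disjoint[OF fin disj]) auto
    then show "?t (K \<union> L) (case x of (q1, q2) \<Rightarrow> q1 \<circ> q2) =
        (case x of (q1, q2) \<Rightarrow> ?t K q1 * ?t L q2)"
      using perm_sign_comp[OF e q1' q2'] fin by (simp add: x ac_simps)
  next
    fix q assume "q \<in> {q. q permutes (K \<union> L) \<and> q ` K = K}"
    then have q: "q permutes (K \<union> L)" and qK: "q ` K = K" by auto
    have "q ` ((K \<union> L) - K) = (K \<union> L) - K"
      using permutes_image[OF q] qK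
      by (metis image_set_diff permutes_inj[OF q])
    then have qL: "q ` L = L"
      using disj by (simp add: Un_Diff Int_commute Diff_triv)
    have inj: "inj_on q X" for X
      using permutes_inj[OF q] by (auto simp: inj_on_def inj_def)
    show "(restrict_id q K, restrict_id q L) \<in> {q. q permutes K} \<times> {q. q permutes L}"
      using qK qL inj by (auto intro!: permutes_restrict_id simp: bij_betw_def)
    show "(case (restrict_id q K, restrict_id q L) of (q1, q2) \<Rightarrow> q1 \<circ> q2) = q"
      using disj qL permutes_not_in[OF q] by (auto simp: fun_eq_iff restrict_id_def)
  qed
  finally show ?thesis by simp
qed

text \<open>Laplace's expansion up to the evaluation of signs. The permutations \<open>s\<close> and \<open>t J\<close> carry the
  fixed block \<open>K\<close> to the chosen rows \<open>s ` K\<close> and to the columns \<open>J\<close>; any such choice is possible,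
  because changing it inside a block alters a sign and a block determinant simultaneously.\<close>

lemma laplace_expansion_reindexed:
  assumes e: "e * e = 1" and fin: "finite K" "finite L" and disj: "K \<inter> L = {}"
    and s: "s permutes (K \<union> L)"
    and t: "\<And>J. J \<subseteq> K \<union> L \<Longrightarrow> card J = card K \<Longrightarrow> t J permutes (K \<union> L) \<and> t J ` K = J"
  shows "det_on e (K \<union> L) a =
    (\<Sum>J | J \<subseteq> K \<union> L \<and> card J = card K. perm_sign e s * perm_sign e (t J) *
       (det_on e K (\<lambda>i j. a (s i) (t J j)) * det_on e L (\<lambda>i j. a (s i) (t J j))))"
proof -
  define N where "N = K \<union> L"
  let ?\<J> = "{J. J \<subseteq> N \<and> card J = card K}"
  let ?term = "\<lambda>p. perm_sign e p * (\<Prod>k\<in>N. a (p k) k)"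
  let ?s' = "inv_into UNIV s"
  have finN: "finite N" using fin by (simp add: N_def)
  have s: "s permutes N" using s by (simp add: N_def)
  have sK: "s ` K \<subseteq> N"
    using permutes_image[OF s] by (auto simp: N_def)
  \<comment> \<open>Group the permutations by the set of columns whose chosen entries lie in the rows \<open>s ` K\<close>.\<close>
  have "det_on e N a = (\<Sum>J\<in>?\<J>. \<Sum>p | p \<in> {p. p permutes N} \<and> p -` (s ` K) = J. ?term p)"
    unfolding det_on_def
  proof (rule sum.group[symmetric])
    show "(\<lambda>p. p -` (s ` K)) ` {p. p permutes N} \<subseteq> ?\<J>"
    proof (clarify, intro conjI)
      fix p assume p: "p permutes N"
      show "p -` s ` K \<subseteq> N"
        using permutes_vimage[OF p] vimage_mono[OF sK, of p] by simp
      show "card (p -` s ` K) = card K"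
        using permutes_inj[OF p] permutes_surj[OF p] permutes_inj[OF s]
        by (metis card_image card_vimage_inj inj_on_subset subset_UNIV)
    qed
  qed (use finN in \<open>auto simp: finite_permutations\<close>)
  also have "\<dots> = (\<Sum>J\<in>?\<J>. perm_sign e s * perm_sign e (t J) *
      (det_on e K (\<lambda>i j. a (s i) (t J j)) * det_on e L (\<lambda>i j. a (s i) (t J j))))"
  proof (rule sum.cong[OF refl])
    fix J assume J: "J \<in> ?\<J>"
    define u where "u = t J"
    let ?u' = "inv_into UNIV u"
    have u: "u permutes N" and uK: "u ` K = J"
      using t[of J] J by (auto simp: N_def u_def)
    let ?b = "\<lambda>i j. a (s i) (u j)"
    have "(\<Sum>p | p \<in> {p. p permutes N} \<and> p -` (s ` K) = J. ?term p) =
        (\<Sum>q | q permutes N \<and> q ` K = K.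
           perm_sign e s * perm_sign e u * (perm_sign e q * (\<Prod>k\<in>N. ?b (q k) k)))"
    proof (rule sum.reindex_bij_witness[of _ "\<lambda>q. s \<circ> q \<circ> ?u'" "\<lambda>p. ?s' \<circ> p \<circ> u"])
      fix p assume "p \<in> {p \<in> {p. p permutes N}. p -` (s ` K) = J}"
      then have p: "p permutes N" and pJ: "p -` (s ` K) = J" by auto
      show "s \<circ> (?s' \<circ> p \<circ> u) \<circ> ?u' = p"
        using permutes_inverses[OF s] permutes_inverses[OF u] by (simp add: fun_eq_iff)
      have q: "?s' \<circ> p \<circ> u permutes N"
        by (intro permutes_compose permutes_inv s p u)
      have "p ` J = s ` K"
        using permutes_surj[OF p] by (simp add: pJ[symmetric] surj_image_vimage_eq)
      moreover have "(?s' \<circ> p \<circ> u) ` K = ?s' ` p ` u ` K"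
        by (simp add: image_image)
      ultimately have "(?s' \<circ> p \<circ> u) ` K = K"
        using permutes_inverses[OF s] by (simp add: uK image_image)
      then show "?s' \<circ> p \<circ> u \<in> {q. q permutes N \<and> q ` K = K}"
        using q by simp
      have "perm_sign e (?s' \<circ> p \<circ> u) = perm_sign e s * (perm_sign e p * perm_sign e u)"
        using perm_sign_comp[OF e permutes_inv[OF s] permutes_compose[OF u p] finN]
        by (simp add: perm_sign_comp[OF e p u finN] perm_sign_inv[OF s finN] o_assoc)
      moreover have "perm_sign e q * (perm_sign e q * c) = c" for q :: "'b \<Rightarrow> 'b" and c
        using e by (simp add: perm_sign_def mult.assoc[symmetric])
      ultimately have "perm_sign e s * perm_sign e u * (perm_sign e (?s' \<circ> p \<circ> u) * c) =
          perm_sign e p * c" for c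
        by (simp add: ac_simps)
      moreover have "(\<Prod>k\<in>N. ?b ((?s' \<circ> p \<circ> u) k) k) = (\<Prod>k\<in>N. a (p k) k)"
        using permutes_inverses[OF s] prod.permute[OF u, of "\<lambda>k. a (p k) k"] by (simp add: o_def)
      ultimately show "perm_sign e s * perm_sign e u * (perm_sign e (?s' \<circ> p \<circ> u) *
          (\<Prod>k\<in>N. ?b ((?s' \<circ> p \<circ> u) k) k)) = ?term p"
        by simp
    next
      fix q assume "q \<in> {q. q permutes N \<and> q ` K = K}"
      then have q: "q permutes N" and qK: "q ` K = K" by auto
      show "?s' \<circ> (s \<circ> q \<circ> ?u') \<circ> u = q"
        using permutes_inverses[OF s] permutes_inverses[OF u] by (simp add: fun_eq_iff)
      have p: "s \<circ> q \<circ> ?u' permutes N"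
        by (intro permutes_compose permutes_inv s q u)
      have "(s \<circ> q \<circ> ?u') ` J = s ` q ` ?u' ` u ` K"
        by (simp add: uK image_image)
      also have "?u' ` u ` K = K"
        using permutes_inverses[OF u] by (simp add: image_image)
      finally have "(s \<circ> q \<circ> ?u') -` (s ` K) = J"
        using inj_vimage_image_eq[OF permutes_inj[OF p], of J] by (simp add: qK)
      then show "s \<circ> q \<circ> ?u' \<in> {p \<in> {p. p permutes N}. p -` (s ` K) = J}"
        using p by simp
    qed
    also have "\<dots> = perm_sign e s * perm_sign e u * (det_on e K ?b * det_on e L ?b)"
      using sum_block_permutations[OF e fin disj, of ?b]
      by (simp add: sum_distrib_left[symmetric] N_def)
    finally show "(\<Sum>p | p \<in> {p. p permutes N} \<and> p -` (s ` K) = J. ?term p) =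
        perm_sign e s * perm_sign e (t J) *
        (det_on e K (\<lambda>i j. a (s i) (t J j)) * det_on e L (\<lambda>i j. a (s i) (t J j)))"
      by (simp add: u_def)
  qed
  finally show ?thesis by (simp add: N_def)
qed

section \<open>The parity of a shuffle\<close>

lemma strict_mono_permutes_eq_id:
  fixes s :: "nat \<Rightarrow> nat"
  assumes s: "s permutes {0..<n}" and mono: "strict_mono_on {0..<n} s"
  shows "s = id"
proof (rule permutes_natset_ge[OF s])
  have "i < n \<Longrightarrow> i \<le> s i" for i
  proof (induction i)
    case (Suc i)
    then have "s i < s (Suc i)" using mono by (auto simp: strict_mono_on_def)
    then show ?case using Suc by simp
  qed simp
  then show "\<forall>i\<in>{0..<n}. i \<le> s i" by simp
qed

text \<open>Induction on the sum of the first block's image \<open>J\<close>. If \<open>J\<close> is an initial segment, then \<open>s\<close> is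
  increasing on the whole interval, hence the identity. Otherwise some \<open>j \<in> J\<close> can be lowered
  to \<open>j - 1 \<notin> J\<close> by an adjacent transposition of values; this changes the parity of \<open>s\<close>, decreases
  the sum by one, and keeps \<open>s\<close> increasing on both blocks because \<open>j\<close> and \<open>j - 1\<close> are attained
  in different blocks.\<close>

lemma evenperm_mono_on_blocks_iff:
  fixes s :: "nat \<Rightarrow> nat"
  assumes "s permutes {0..<n}" "m \<le> n"
    and "strict_mono_on {0..<m} s" "strict_mono_on {m..<n} s"
  shows "evenperm s \<longleftrightarrow> even (\<Sum>(s ` {0..<m}) + \<Sum>{0..<m})"
  using assms
proof (induction "\<Sum>(s ` {0..<m})" arbitrary: s rule: less_induct)
  case less
  note s = \<open>s permutes {0..<n}\<close> and mn = \<open>m \<le> n\<close>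
  have lo: "s a < s b" if "a < b" "b < m" for a b
    using less.prems(3) that by (auto simp: strict_mono_on_def)
  have hi: "s a < s b" if "m \<le> a" "a < b" "b < n" for a b
    using less.prems(4) that by (auto simp: strict_mono_on_def)
  have inj: "s a = s b \<longleftrightarrow> a = b" for a b
    using permutes_inj[OF s] by (auto simp: inj_def)
  let ?J = "s ` {0..<m}"
  show ?case
  proof (cases "\<exists>j\<in>?J. j > 0 \<and> j - 1 \<notin> ?J")
    case False
    have down: "j - d \<in> ?J" if "j \<in> ?J" for j d
    proof (induction d)
      case (Suc d)
      show ?case
      proof (cases "j - d = 0")
        case True
        then show ?thesis using Suc.IH by simp
      next
        case nz: False
        then have "j - d - 1 \<in> ?J" using Suc.IH False by blast
        then show ?thesis by simp
      qed
    qed (use that in simp)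
    have "strict_mono_on {0..<n} s"
    proof (rule strict_mono_onI)
      fix a b assume ab: "a \<in> {0..<n}" "b \<in> {0..<n}" "a < b"
      \<comment> \<open>Across the blocks, \<open>s b \<le> s a\<close> would put \<open>s b\<close> into the initial segment \<open>s ` {0..<m}\<close>.\<close>
      consider "b < m" | "m \<le> a" | "a < m" "m \<le> b" by linarith
      then show "s a < s b"
      proof cases
        case 3
        have "s b \<notin> ?J" using 3 inj by auto
        moreover have "s b \<in> ?J" if "s b \<le> s a"
          using down[of "s a" "s a - s b"] that 3 by simp
        ultimately show ?thesis by force
      qed (use ab lo hi in auto)
    qed
    then have "s = id" by (rule strict_mono_permutes_eq_id[OF s])
    then show ?thesis by simp
  next
    case True
    then obtain k where k: "k < m" "s k > 0" and notin: "s k - 1 \<notin> ?J" by auto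
    define j where "j = s k"
    have j: "s k = j" "0 < j" "s k \<noteq> 0" using k by (auto simp: j_def)
    have notj: "s a \<noteq> j - 1" if "a < m" for a
      using notin that unfolding j_def by (metis atLeastLessThan_iff imageI le0)
    have jn: "j < n"
      using permutes_in_image[OF s, of k] k mn j by auto
    define s' where "s' = transpose (j - 1) j \<circ> s"
    have s': "s' permutes {0..<n}"
      unfolding s'_def using jn by (intro permutes_compose[OF s] permutes_swap_id) auto
    have s'_lo: "s' a = (if a = k then j - 1 else s a)" if "a < m" for a
      using notj[OF that] j inj[of a k] by (auto simp: s'_def transpose_def)
    have s'_hi: "s' a = (if s a = j - 1 then j else s a)" if "m \<le> a" for a
      using that k inj[of a k] j by (auto simp: s'_def transpose_def)
    have mono1: "strict_mono_on {0..<m} s'"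
    proof (rule strict_mono_onI)
      fix a b assume ab: "a \<in> {0..<m}" "b \<in> {0..<m}" "a < b"
      then have "s a < s b" using lo by simp
      then show "s' a < s' b"
        using ab notj[of a] j by (auto simp: s'_lo)
    qed
    have mono2: "strict_mono_on {m..<n} s'"
    proof (rule strict_mono_onI)
      fix a b assume ab: "a \<in> {m..<n}" "b \<in> {m..<n}" "a < b"
      then have "s a < s b" using hi by simp
      moreover have "s b \<noteq> j" using ab k inj[of b k] j by auto
      ultimately show "s' a < s' b"
        using ab by (auto simp: s'_hi)
    qed
    have sum_image: "\<Sum>(r ` {0..<m}) = (\<Sum>a = 0..<m. r a)"
      if "r permutes {0..<n}" for r :: "nat \<Rightarrow> nat"
      using permutes_inj[OF that] by (subst sum.reindex) (auto simp: inj_on_def inj_def)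
    have "(\<Sum>a = 0..<m. s a) = j + (\<Sum>a\<in>{0..<m} - {k}. s a)"
      using k j by (subst sum.remove[of _ k]) auto
    moreover have "(\<Sum>a = 0..<m. s' a) = (j - 1) + (\<Sum>a\<in>{0..<m} - {k}. s a)"
      using k by (subst sum.remove[of _ k]) (auto simp: s'_lo intro!: sum.cong)
    ultimately have sum: "\<Sum>(s ` {0..<m}) = Suc (\<Sum>(s' ` {0..<m}))"
      using j by (simp add: sum_image s s')
    have "evenperm s' \<longleftrightarrow> \<not> evenperm s"
      unfolding s'_def using j s
      by (subst evenperm_comp)
        (auto simp: evenperm_swap permutation_swap_id intro: permutes_imp_permutation[OF _ s])
    moreover have "evenperm s' \<longleftrightarrow> even (\<Sum>(s' ` {0..<m}) + \<Sum>{0..<m})"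
      by (rule less.hyps) (use sum s' mn mono1 mono2 in simp_all)
    ultimately show ?thesis by (simp add: sum)
  qed
qed

text \<open>The value \<open>k\<close> outside the interval makes this a permutation in the sense of
  \<^const>\<open>permutes\<close>.\<close>

definition shuffle :: "nat \<Rightarrow> nat set \<Rightarrow> nat \<Rightarrow> nat" where
  "shuffle n J k =
    (if k < card J then pick J k
     else if k < n then pick ({0..<n} - J) (k - card J) else k)"

lemma pick_strict_mono_on: "strict_mono_on {0..<card S} (pick S)"
  by (auto intro!: strict_mono_onI pick_mono)

lemma image_pick: "pick S ` {0..<card S} = S" if "finite S"
proof (rule card_subset_eq[OF that])
  show "pick S ` {0..<card S} \<subseteq> S" by (auto intro: pick_in_set)
  show "card (pick S ` {0..<card S}) = card S"
    using strict_mono_on_imp_inj_on[OF pick_strict_mono_on] by (simp add: card_image)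
qed

context
  fixes n :: nat and J :: "nat set"
  assumes J: "J \<subseteq> {0..<n}"
begin

lemma card_le_of_subset_interval: "card J \<le> n"
  using card_mono[OF _ J] by simp

lemma card_interval_Diff: "card ({0..<n} - J) = n - card J"
  using J by (simp add: card_Diff_subset finite_subset)

lemma shuffle_image_low: "shuffle n J ` {0..<card J} = J"
  using image_pick[of J] finite_subset[OF J] by (auto simp: shuffle_def cong: image_cong_simp)

lemma shuffle_image_high: "shuffle n J ` {card J..<n} = {0..<n} - J"
proof -
  have "shuffle n J ` {card J..<n} =
      (\<lambda>k. pick ({0..<n} - J) (k - card J)) ` {card J..<n}"
    by (rule image_cong) (auto simp: shuffle_def)
  also have "\<dots> = pick ({0..<n} - J) ` (\<lambda>k. k - card J) ` {card J..<n}"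
    by (simp add: image_image)
  also have "(\<lambda>k. k - card J) ` {card J..<n} = {0..<n - card J}"
    using card_le_of_subset_interval by (auto simp: image_iff intro!: bexI[of _ "_ + card J"])
  finally show ?thesis
    using image_pick[of "{0..<n} - J"] by (simp add: card_interval_Diff)
qed

lemma shuffle_permutes: "shuffle n J permutes {0..<n}"
proof (rule bij_imp_permutes)
  have "{0..<n} = {0..<card J} \<union> {card J..<n}" using card_le_of_subset_interval by auto
  then have "shuffle n J ` {0..<n} = {0..<n}"
    using shuffle_image_low shuffle_image_high J by (simp add: image_Un) blast
  then show "bij_betw (shuffle n J) {0..<n} {0..<n}"
    by (simp add: bij_betw_def eq_card_imp_inj_on)
qed (simp add: shuffle_def card_le_of_subset_interval, use card_le_of_subset_interval in linarith)

lemma evenperm_shuffle_iff: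
  "evenperm (shuffle n J) \<longleftrightarrow> even (\<Sum>J + \<Sum>{0..<card J})"
proof -
  have "strict_mono_on {0..<card J} (shuffle n J)"
    by (auto intro!: strict_mono_onI pick_mono simp: shuffle_def)
  moreover have "strict_mono_on {card J..<n} (shuffle n J)"
    by (auto intro!: strict_mono_onI pick_mono simp: shuffle_def card_interval_Diff)
  ultimately show ?thesis
    using evenperm_mono_on_blocks_iff[OF shuffle_permutes card_le_of_subset_interval]
    by (simp add: shuffle_image_low)
qed

end

section \<open>Determinants with a negation map\<close>

text \<open>In this section a negation map enters only as multiplication by \<open>e\<close>. As \<^const>\<open>neg_set\<close>
  counts indices from \<open>1\<close>, the cardinality of \<open>J\<close> appears next to the sum of its elements.\<close>

lemma neg_set_conv:
  fixes neg :: "'a::{comm_semiring_0,comm_monoid_mult} \<Rightarrow> 'a"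
  assumes neg: "\<And>b. neg b = e * b"
  shows "neg_set neg J b = (if even (\<Sum>J + card J) then 1 else e) * b"
proof -
  have "(\<Sum>j\<in>J. Suc j) = \<Sum>J + card J"
    by (simp add: sum_Suc)
  then show ?thesis
    by (simp add: neg_set_def neg_pow_def neg)
qed

lemma neg_det_conv_det_on:
  assumes neg: "\<And>b. neg b = e * b" and A: "A \<in> carrier_mat n n"
  shows "neg_det neg A = det_on e {0..<n} (\<lambda>i j. A $$ (i, j))"
proof -
  have "neg_perm neg p b = perm_sign e p * b" for p b
    by (simp add: neg_perm_def perm_sign_def neg)
  then show ?thesis
    using A by (simp add: neg_det_def det_on_def)
qed

lemma submatrix_carrier:
  assumes "A \<in> carrier_mat n n" "I \<subseteq> {0..<n}" "J \<subseteq> {0..<n}"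
  shows "submatrix A I J \<in> carrier_mat (card I) (card J)"
proof -
  have "{i. i < n \<and> i \<in> I} = I" "{j. j < n \<and> j \<in> J} = J" using assms by auto
  then show ?thesis
    using assms(1) by (intro carrier_matI) (simp_all only: dim_submatrix carrier_matD)
qed

lemma submatrix_nth:
  assumes "A \<in> carrier_mat n n" "I \<subseteq> {0..<n}" "J \<subseteq> {0..<n}" "i < card I" "j < card J"
  shows "submatrix A I J $$ (i, j) = A $$ (pick I i, pick J j)"
proof -
  have "{i. i < n \<and> i \<in> I} = I" "{j. j < n \<and> j \<in> J} = J" using assms by auto
  then show ?thesis using assms by (auto intro!: submatrix_index)
qed

lemma neg_det_submatrix:
  assumes neg: "\<And>b. neg b = e * b" and A: "A \<in> carrier_mat n n"
    and I: "I \<subseteq> {0..<n}" and J: "J \<subseteq> {0..<n}" and card: "card J = card I"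
  shows "neg_det neg (submatrix A I J) =
    det_on e {0..<card I} (\<lambda>i j. A $$ (shuffle n I i, shuffle n J j))"
proof -
  have "neg_det neg (submatrix A I J) =
      det_on e {0..<card I} (\<lambda>i j. submatrix A I J $$ (i, j))"
    using submatrix_carrier[OF A I J] card by (intro neg_det_conv_det_on neg) simp
  also have "\<dots> = det_on e {0..<card I} (\<lambda>i j. A $$ (shuffle n I i, shuffle n J j))"
    by (rule det_on_cong) (simp add: submatrix_nth[OF A I J] shuffle_def card)
  finally show ?thesis .
qed

text \<open>The complementary minor is the determinant of the second diagonal block of the shuffled matrix,
  so that the two kinds of minors are the two factors of \<open>laplace_expansion_reindexed\<close>.\<close>

lemma complementary_minor_conv_det_on:
  assumes neg: "\<And>b. neg b = e * b" and A: "A \<in> carrier_mat n n"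
    and I: "I \<subseteq> {0..<n}" and J: "J \<subseteq> {0..<n}" and card: "card J = card I"
  shows "complementary_minor neg A I J =
    det_on e {card I..<n} (\<lambda>i j. A $$ (shuffle n I i, shuffle n J j))"
proof -
  let ?I = "{0..<n} - I" and ?J = "{0..<n} - J"
  have cI: "card ?I = n - card I" and cJ: "card ?J = n - card I"
    by (simp_all only: card_interval_Diff[OF I] card_interval_Diff[OF J] card)
  have "complementary_minor neg A I J = neg_det neg (submatrix A ?I ?J)"
    using A by (simp only: complementary_minor_def carrier_matD)
  also have "\<dots> = det_on e {0..<n - card I} (\<lambda>i j. submatrix A ?I ?J $$ (i, j))"
    using submatrix_carrier[OF A, of ?I ?J] cI cJ by (intro neg_det_conv_det_on neg) simp
  also have "\<dots> = det_on e {0..<n - card I}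
      (\<lambda>i j. A $$ (shuffle n I (card I + i), shuffle n J (card I + j)))"
    by (rule det_on_cong) (use cI cJ card in \<open>auto simp: submatrix_nth[OF A] shuffle_def\<close>)
  also have "\<dots> = det_on e {card I..<n} (\<lambda>i j. A $$ (shuffle n I i, shuffle n J j))"
  proof (rule det_on_reindex[symmetric])
    show "bij_betw ((+) (card I)) {0..<n - card I} {card I..<n}"
      using card_le_of_subset_interval[OF I]
      by (intro bij_betw_imageI) (auto simp: image_add_atLeastLessThan)
  qed simp
  finally show ?thesis .
qed

lemma laplace_expansion_neg_det:
  assumes neg: "\<And>b. neg b = e * b" and e: "e * e = 1"
    and A: "A \<in> carrier_mat n n" and I: "I \<subseteq> {0..<n}"
  shows "neg_det neg A =
    (\<Sum>J | J \<subseteq> {0..<n} \<and> card J = card I.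
       neg_set neg I (neg_set neg J
         (complementary_minor neg A I J * neg_det neg (submatrix A I J))))"
proof -
  let ?K = "{0..<card I}" and ?L = "{card I..<n}"
  have KL: "?K \<union> ?L = {0..<n}" using card_le_of_subset_interval[OF I] by auto
  \<comment> \<open>Two shifts of the exponents cancel between \<open>I\<close> and \<open>J\<close>: the sum of \<open>{0..<card I}\<close> coming from
    the shuffles and the summand \<open>card I\<close> coming from the numbering from \<open>1\<close>.\<close>
  have sign: "perm_sign e (shuffle n I) * perm_sign e (shuffle n J) * b =
      neg_set neg I (neg_set neg J b)" if "J \<subseteq> {0..<n}" "card J = card I" for J b
  proof -
    have "perm_sign e (shuffle n X) = (if even (\<Sum>X + \<Sum>{0..<card X}) then 1 else e)"
      if "X \<subseteq> {0..<n}" for X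
      by (simp add: perm_sign_def evenperm_shuffle_iff[OF that])
    then show ?thesis
      using that I e by (auto simp: neg_set_conv[of neg e, OF neg] mult.assoc[symmetric])
  qed
  have "neg_det neg A = det_on e (?K \<union> ?L) (\<lambda>i j. A $$ (i, j))"
    by (simp only: KL neg_det_conv_det_on[of neg e, OF neg A])
  also have "\<dots> = (\<Sum>J | J \<subseteq> ?K \<union> ?L \<and> card J = card ?K.
      perm_sign e (shuffle n I) * perm_sign e (shuffle n J) *
      (det_on e ?K (\<lambda>i j. A $$ (shuffle n I i, shuffle n J j)) *
       det_on e ?L (\<lambda>i j. A $$ (shuffle n I i, shuffle n J j))))"
  proof (rule laplace_expansion_reindexed[OF e])
    show "shuffle n I permutes ?K \<union> ?L"
      unfolding KL by (rule shuffle_permutes[OF I])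
    show "shuffle n J permutes ?K \<union> ?L \<and> shuffle n J ` ?K = J"
      if "J \<subseteq> ?K \<union> ?L" "card J = card ?K" for J
      using that shuffle_permutes[of J n] shuffle_image_low[of J n] unfolding KL by simp
  qed auto
  also have "\<dots> = (\<Sum>J | J \<subseteq> {0..<n} \<and> card J = card I.
       neg_set neg I (neg_set neg J
         (complementary_minor neg A I J * neg_det neg (submatrix A I J))))"
    unfolding KL
  proof (rule sum.cong)
    fix J assume "J \<in> {J. J \<subseteq> {0..<n} \<and> card J = card I}"
    then have J: "J \<subseteq> {0..<n}" "card J = card I" by auto
    show "perm_sign e (shuffle n I) * perm_sign e (shuffle n J) *
        (det_on e ?K (\<lambda>i j. A $$ (shuffle n I i, shuffle n J j)) *
         det_on e ?L (\<lambda>i j. A $$ (shuffle n I i, shuffle n J j))) =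
        neg_set neg I (neg_set neg J
          (complementary_minor neg A I J * neg_det neg (submatrix A I J)))"
      unfolding sign[OF J] neg_det_submatrix[of neg e, OF neg A I J]
        complementary_minor_conv_det_on[of neg e, OF neg A I J]
      by (simp only: mult.commute)
  qed simp
  finally show ?thesis .
qed

section \<open>Expansion along a single row\<close>

text \<open>Deleting one row and one column passes to complements of singletons, which identifies the
  cofactors with complementary minors.\<close>

lemma pick_compl_singleton:
  assumes "k < n - 1" "i < n"
  shows "pick ({0..<n} - {i}) k = insert_index i k"
proof -
  let ?S = "{0..<n} - {i}"
  have "{a \<in> ?S. a < insert_index i k} = (if k < i then {0..<k} else {0..<Suc k} - {i})"
    using assms by (auto simp: insert_index_def)
  then have "card {a \<in> ?S. a < insert_index i k} = k"
    by simp
  moreover have "insert_index i k \<in> ?S"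
    using assms by (auto simp: insert_index_def)
  ultimately show ?thesis
    using pick_card_in_set by metis
qed

lemma mat_delete_eq_submatrix:
  assumes A: "A \<in> carrier_mat n n" and "i < n" "j < n"
  shows "mat_delete A i j = submatrix A ({0..<n} - {i}) ({0..<n} - {j})"
proof -
  let ?S = "submatrix A ({0..<n} - {i}) ({0..<n} - {j})"
  have card: "card ({0..<n} - {i}) = n - 1" "card ({0..<n} - {j}) = n - 1"
    using assms by simp_all
  have S: "?S \<in> carrier_mat (n - 1) (n - 1)"
    using submatrix_carrier[OF A, of "{0..<n} - {i}" "{0..<n} - {j}"] unfolding card by blast
  show ?thesis
  proof (rule eq_matI)
    fix k l assume "k < dim_row ?S" "l < dim_col ?S"
    then have kl: "k < n - 1" "l < n - 1"
      by (simp_all only: carrier_matD[OF S])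
    have "?S $$ (k, l) = A $$ (pick ({0..<n} - {i}) k, pick ({0..<n} - {j}) l)"
      by (rule submatrix_nth[OF A]) (use kl card in auto)
    also have "\<dots> = A $$ (insert_index i k, insert_index j l)"
      by (simp only: pick_compl_singleton kl assms)
    also have "\<dots> = mat_delete A i j $$ (k, l)"
      using A kl by (simp add: mat_delete_def insert_index_def)
    finally show "mat_delete A i j $$ (k, l) = ?S $$ (k, l)" by (rule sym)
  qed (simp_all only: carrier_matD[OF S] carrier_matD[OF A] mat_delete_dim)
qed

lemma neg_det_singleton_submatrix:
  assumes A: "A \<in> carrier_mat n n" and "i < n" "j < n"
  shows "neg_det neg (submatrix A {i} {j}) = A $$ (i, j)"
proof -
  have "submatrix A {i} {j} \<in> carrier_mat 1 1"
    using submatrix_carrier[OF A, of "{i}" "{j}"] assms by simp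
  moreover have "pick {k} 0 = k" for k
    by (simp add: Least_equality)
  ultimately show ?thesis
    using submatrix_nth[OF A, of "{i}" "{j}" 0 0] assms
    by (simp add: neg_det_def neg_perm_def)
qed

theorem theorem6:
  fixes T A0 :: "'a::{comm_semiring_0,comm_monoid_mult} set"
    and neg :: "'a \<Rightarrow> 'a" and A :: "'a mat" and n :: nat
  assumes "standing_semiring_pair T A0"
    and "negation_map T A0 neg"
    and "A \<in> carrier_mat n n"
  shows "(\<forall>i<n. neg_det neg A =
            (\<Sum>j = 0..<n. neg_pow neg (Suc i + Suc j) (comatrix_entry neg A i j * A $$ (i, j)))) \<and>
         (\<forall>m I. I \<subseteq> {0..<n} \<and> card I = m \<longrightarrow> neg_det neg A =
            (\<Sum>J | J \<subseteq> {0..<n} \<and> card J = m.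
               neg_set neg I (neg_set neg J
                 (complementary_minor neg A I J * neg_det neg (submatrix A I J)))))"
proof -
  interpret standing_semiring_pair T A0 by (rule assms(1))
  interpret negation_map T A0 neg by (rule assms(2))
  define e where "e = neg 1"
  \<comment> \<open>The compatibility of \<open>neg\<close> with the action of \<open>T\<close>, applied to the scalar \<open>1\<close>.\<close>
  have neg: "neg b = e * b" for b
    using neg_mult_left[OF T_one, of b] by (simp add: e_def)
  have e: "e * e = 1"
    using neg[of e] neg_neg[of 1] by (simp add: e_def)
  have general: "neg_det neg A =
      (\<Sum>J | J \<subseteq> {0..<n} \<and> card J = card I.
         neg_set neg I (neg_set neg J
           (complementary_minor neg A I J * neg_det neg (submatrix A I J))))"
    if "I \<subseteq> {0..<n}" for I
    by (rule laplace_expansion_neg_det[of neg e, OF neg e assms(3) that])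
  have "neg_det neg A =
      (\<Sum>j = 0..<n. neg_pow neg (Suc i + Suc j) (comatrix_entry neg A i j * A $$ (i, j)))"
    if i: "i < n" for i
  proof -
    have "neg_det neg A = (\<Sum>J | J \<subseteq> {0..<n} \<and> card J = card {i}.
         neg_set neg {i} (neg_set neg J
           (complementary_minor neg A {i} J * neg_det neg (submatrix A {i} J))))"
      by (rule general) (use i in simp)
    also have "{J. J \<subseteq> {0..<n} \<and> card J = card {i}} = (\<lambda>j. {j}) ` {0..<n}"
      by (auto simp: card_1_singleton_iff)
    also have "(\<Sum>J\<in>(\<lambda>j. {j}) ` {0..<n}. neg_set neg {i} (neg_set neg J
           (complementary_minor neg A {i} J * neg_det neg (submatrix A {i} J)))) =
        (\<Sum>j = 0..<n. neg_set neg {i} (neg_set neg {j}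
           (complementary_minor neg A {i} {j} * neg_det neg (submatrix A {i} {j}))))"
      by (subst sum.reindex) auto
    also have "\<dots> =
        (\<Sum>j = 0..<n. neg_pow neg (Suc i + Suc j) (comatrix_entry neg A i j * A $$ (i, j)))"
    proof (rule sum.cong[OF refl])
      fix j assume "j \<in> {0..<n}"
      then have j: "j < n" by simp
      have "complementary_minor neg A {i} {j} = comatrix_entry neg A i j"
        using assms(3) mat_delete_eq_submatrix[OF assms(3) i j]
        by (auto simp: complementary_minor_def comatrix_entry_def)
      then show "neg_set neg {i} (neg_set neg {j}
          (complementary_minor neg A {i} {j} * neg_det neg (submatrix A {i} {j}))) =
          neg_pow neg (Suc i + Suc j) (comatrix_entry neg A i j * A $$ (i, j))"
        using neg_neg
        by (simp add: neg_det_singleton_submatrix[OF assms(3) i j] neg_set_def neg_pow_def)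
    qed
    finally show ?thesis .
  qed
  with general show ?thesis by blast
qed

end
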